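(* Let $\rho$ be a density operator (mixed state) on $\mathbb{C}^2\otimes\mathbb{C}^2$, and let $\mathbb{P}(1)_\rho$ be the probability of detecting the ancilla in the state $|1\rangle$ at the output of the swap test circuit with input $\rho\otimes|0\rangle\langle0|$. Then the concurrence $C(\rho)$ satisfies $$C(\rho)\ \ge\ f\big(\mathbb{P}(1)_\rho\big),$$ where $f:[0,1]\to\mathbb{R}$ is defined by $f(x)=0$ for $x\le\frac12$ and $f(x)=2x-1$ for $x>\frac12$. Consequently, if $\mathbb{P}(1)_\rho>\frac12$, then $\rho$ is entangled.
   Context: For a normalized pure state $|\psi\rangle=\alpha|00\rangle+\gamma|10\rangle+\delta|01\rangle+\beta|11\rangle$ in $\mathbb{C}^2\otimes\mathbb{C}^2$, the concurrence is $C(|\psi\rangle):=2|\alpha\beta-\gamma\delta|$. For a density operator $\rho$ on $\mathbb{C}^2\otimes\mathbb{C}^2$, the concurrence is $C(\rho):=\min_{\{p_i,|\psi_i\rangle\}}\sum_i p_i\,C(|\psi_i\rangle)$. The minimum is over all pure-state decompositions $\rho=\sum_i p_i|\psi_i\rangle\langle\psi_i|$ with $p_i\ge0$, $\sum_i p_i=1$ and each $|\psi_i\rangle$ normalized. The state $\rho$ is separable if it is a convex combination of product states, and entangled otherwise. The swap test circuit acts on $\mathbb{C}^2\otimes\mathbb{C}^2\otimes\mathbb{C}^2$. The first two factors are the target qubits and the third is the ancilla. The circuit implements the unitary $U_{\mathrm{SWAP}} = (\mathbb{1}\otimes H)\, U_{\mathrm{CSWAP}}\, (\mathbb{1}\otimes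 H)$, where: - $\mathbb{1}$ is the identity on $\mathbb{C}^2\otimes\mathbb{C}^2$; - $H=\frac{1}{\sqrt2}\begin{pmatrix}1&1\\1&-1\end{pmatrix}$ is the Hadamard gate, acting on the ancilla; - $U_{\mathrm{CSWAP}}=\mathbb{1}\otimes|0\rangle\langle 0| + S\otimes |1\rangle\langle 1|$, with $S$ the swap operator $S(|u\rangle\otimes|v\rangle)=|v\rangle\otimes|u\rangle$ on $\mathbb{C}^2\otimes\mathbb{C}^2$. The probability is $\mathbb{P}(1)_\rho = \mathrm{Tr}\left[(\mathbb{1}\otimes|1\rangle\langle1|)\,U_{\mathrm{SWAP}}(\rho\otimes|0\rangle\langle0|)U_{\mathrm{SWAP}}^\dagger\right]$. *)

theory Defs
  imports "HOL-Analysis.Analysis"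
begin

text \<open>
  A qubit is \<^typ>\<open>complex ^ 2\<close> with basis indices \<open>0\<close> and \<open>1\<close> of the numeral type \<open>2\<close>;
  a tensor product of spaces is indexed by the product of the index types, so that component
  \<open>(i, j)\<close> is the coefficient of \<open>|i j>\<close>.
\<close>

type_synonym 'n cvec = "(complex, 'n) vec"
type_synonym 'n cmat = "((complex, 'n) vec, 'n) vec"

definition tensor_vec :: "'a::finite cvec \<Rightarrow> 'b::finite cvec \<Rightarrow> ('a \<times> 'b) cvec"
    (infixr "\<otimes>\<^sub>v" 72) where
  "u \<otimes>\<^sub>v v = (\<chi> i. u $ fst i * v $ snd i)"

definition tensor_mat :: "'a::finite cmat \<Rightarrow> 'b::finite cmat \<Rightarrow> ('a \<times> 'b) cmat"
    (infixr "\<otimes>\<^sub>m" 72) where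
  "A \<otimes>\<^sub>m B = (\<chi> i j. A $ fst i $ fst j * B $ snd i $ snd j)"

definition cinner :: "'n::finite cvec \<Rightarrow> 'n cvec \<Rightarrow> complex" where
  "cinner u v = (\<Sum>i\<in>UNIV. cnj (u $ i) * v $ i)"

definition dagger :: "'n::finite cmat \<Rightarrow> 'n cmat" where
  "dagger A = (\<chi> i j. cnj (A $ j $ i))"

definition ketbra :: "'n::finite cvec \<Rightarrow> 'n cvec \<Rightarrow> 'n cmat" where
  "ketbra u v = (\<chi> i j. u $ i * cnj (v $ j))"

definition ket :: "'n::finite \<Rightarrow> 'n cvec" where
  "ket i = axis i 1"

definition density_operator :: "'n::finite cmat \<Rightarrow> bool" where
  "density_operator \<rho> \<longleftrightarrow>
     dagger \<rho> = \<rho> \<and> (\<forall>v. 0 \<le> Re (cinner v (\<rho> *v v))) \<and> trace \<rho> = 1"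

definition pure_concurrence :: "(2 \<times> 2) cvec \<Rightarrow> real" where
  "pure_concurrence \<psi> = 2 * cmod (\<psi> $ (0, 0) * \<psi> $ (1, 1) - \<psi> $ (1, 0) * \<psi> $ (0, 1))"

definition pure_decomposition ::
    "'n::finite cmat \<Rightarrow> nat \<Rightarrow> (nat \<Rightarrow> real) \<Rightarrow> (nat \<Rightarrow> 'n cvec) \<Rightarrow> bool" where
  "pure_decomposition \<rho> n p \<psi> \<longleftrightarrow>
     (\<forall>i<n. 0 \<le> p i) \<and> (\<Sum>i<n. p i) = 1 \<and> (\<forall>i<n. norm (\<psi> i) = 1) \<and>
     \<rho> = (\<Sum>i<n. p i *\<^sub>R ketbra (\<psi> i) (\<psi> i))"

text \<open>
  \<open>LEAST\<close> (rather than \<open>Inf\<close>) says that the value is a minimum. It is attained for density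
  operators: \<open>(\<rho>, c)\<close> ranges over the convex hull of the compact set of all
  \<open>(ketbra \<psi> \<psi>, pure_concurrence \<psi>)\<close> with \<open>\<psi>\<close> normalized.
\<close>

definition concurrence :: "(2 \<times> 2) cmat \<Rightarrow> real" where
  "concurrence \<rho> =
     (LEAST c. \<exists>n p \<psi>. pure_decomposition \<rho> n p \<psi> \<and> c = (\<Sum>i<n. p i * pure_concurrence (\<psi> i)))"

definition separable_state :: "(2 \<times> 2) cmat \<Rightarrow> bool" where
  "separable_state \<rho> \<longleftrightarrow>
     \<rho> \<in> convex hull {\<sigma> \<otimes>\<^sub>m \<tau> | (\<sigma> :: 2 cmat) (\<tau> :: 2 cmat).
                        density_operator \<sigma> \<and> density_operator \<tau>}"

definition entangled :: "(2 \<times> 2) cmat \<Rightarrow> bool" where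
  "entangled \<rho> \<longleftrightarrow> \<not> separable_state \<rho>"

definition hadamard :: "2 cmat" where
  "hadamard = (\<chi> i j. (if i = 1 \<and> j = 1 then - 1 else 1) / complex_of_real (sqrt 2))"

definition swap_op :: "(2 \<times> 2) cmat" where
  "swap_op = (\<chi> i j. if i = prod.swap j then 1 else 0)"

lemma swap_op_tensor: "swap_op *v (u \<otimes>\<^sub>v v) = v \<otimes>\<^sub>v u"
proof -
  have "(swap_op *v (u \<otimes>\<^sub>v v)) $ i = (v \<otimes>\<^sub>v u) $ i" for i
  proof -
    have "(swap_op *v (u \<otimes>\<^sub>v v)) $ i =
        (\<Sum>j\<in>UNIV. if j = prod.swap i then (u \<otimes>\<^sub>v v) $ j else 0)"
      unfolding matrix_vector_mult_def swap_op_def vec_lambda_beta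
      by (rule sum.cong) auto
    also have "\<dots> = (v \<otimes>\<^sub>v u) $ i"
      by (simp add: tensor_vec_def)
    finally show ?thesis .
  qed
  then show ?thesis by (simp add: vec_eq_iff)
qed

definition cswap_gate :: "((2 \<times> 2) \<times> 2) cmat" where
  "cswap_gate = mat 1 \<otimes>\<^sub>m ketbra (ket 0) (ket 0) + swap_op \<otimes>\<^sub>m ketbra (ket 1) (ket 1)"

definition swap_test_unitary :: "((2 \<times> 2) \<times> 2) cmat" where
  "swap_test_unitary = (mat 1 \<otimes>\<^sub>m hadamard) ** cswap_gate ** (mat 1 \<otimes>\<^sub>m hadamard)"

text \<open>The trace is a real number when \<open>\<rho>\<close> is Hermitian; \<open>Re\<close> is only a type conversion.\<close>

definition prob_one :: "(2 \<times> 2) cmat \<Rightarrow> real" where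
  "prob_one \<rho> =
     Re (trace ((mat 1 \<otimes>\<^sub>m ketbra (ket 1) (ket 1)) **
       (swap_test_unitary ** (\<rho> \<otimes>\<^sub>m ketbra (ket 0) (ket 0)) ** dagger swap_test_unitary)))"

definition concurrence_bound :: "real \<Rightarrow> real" where
  "concurrence_bound x = (if x \<le> 1/2 then 0 else 2 * x - 1)"

end

theory Submission
  imports Defs
begin

text \<open>
  The swap test gives \<open>2 P(1) - 1 = - Tr (S \<rho>)\<close>, which is linear in \<open>\<rho>\<close>. On a pure state it is
  \<open>- |\<alpha>|\<^sup>2 - |\<beta>|\<^sup>2 - 2 Re (\<gamma> cnj \<delta>) \<le> 2 |\<gamma>\<delta>| - 2 |\<alpha>\<beta>|\<close>, hence at most the concurrence, and the bound passes
  to an optimal pure-state decomposition of \<open>\<rho>\<close>. On a product state \<open>Tr (S (\<sigma> \<otimes> \<tau>)) = Tr (\<sigma> \<tau>) \<ge> 0\<close>,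
  so \<open>P(1) \<le> 1/2\<close> for separable states. An optimal decomposition exists because a pure-state
  decomposition exists (Cholesky elimination) and the convex hull of the compact graph of the
  concurrence on pure states is compact.
\<close>

section \<open>Positive semidefinite matrices as sums of rank-one projectors\<close>

text \<open>This is \<open>density_operator\<close> without the trace condition, so that it survives
  the subtraction of a suitable rank-one term.\<close>

definition positive_semidefinite :: "'n::finite cmat \<Rightarrow> bool" where
  "positive_semidefinite A \<longleftrightarrow> dagger A = A \<and> (\<forall>v. 0 \<le> Re (cinner v (A *v v)))"

lemma cinner_diff_left: "cinner (u - v) w = cinner u w - cinner v w"
  by (simp add: cinner_def sum_subtractf algebra_simps)

lemma cinner_diff_right: "cinner w (u - v) = cinner w u - cinner w v"
  by (simp add: cinner_def sum_subtractf algebra_simps)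

lemma cinner_scale_left: "cinner (c *s u) w = cnj c * cinner u w"
  by (simp add: cinner_def sum_distrib_left algebra_simps)

lemma cinner_scale_right: "cinner w (c *s u) = c * cinner w u"
  by (simp add: cinner_def sum_distrib_left algebra_simps)

lemma cinner_commute: "cinner u v = cnj (cinner v u)"
  by (simp add: cinner_def mult.commute)

lemma cinner_axis_left: "cinner (axis k 1) v = v $ k"
proof -
  have "cnj (axis k 1 $ i) * v $ i = (if i = k then v $ i else 0)" for i
    by (simp add: axis_def)
  then show ?thesis by (simp add: cinner_def)
qed

lemma cinner_self: "cinner v v = complex_of_real ((norm v)\<^sup>2)"
  by (simp add: cinner_def norm_vec_def L2_set_def sum_nonneg complex_norm_square
      mult.commute del: of_real_power)

lemma matrix_vector_mult_axis: "(A :: 'n::finite cmat) *v axis k 1 = column k A"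
  by (simp add: vec_eq_iff matrix_vector_mult_def column_def axis_def if_distrib cong: if_cong)

lemma cinner_dagger: "cinner (dagger A *v u) v = cinner u (A *v v)"
proof -
  have "cinner (dagger A *v u) v = (\<Sum>i\<in>UNIV. \<Sum>j\<in>UNIV. A $ j $ i * cnj (u $ j) * v $ i)"
    by (simp add: cinner_def dagger_def matrix_vector_mult_def sum_distrib_right)
  also have "\<dots> = (\<Sum>j\<in>UNIV. \<Sum>i\<in>UNIV. A $ j $ i * cnj (u $ j) * v $ i)"
    by (rule sum.swap)
  also have "\<dots> = cinner u (A *v v)"
    by (simp add: cinner_def matrix_vector_mult_def sum_distrib_left algebra_simps)
  finally show ?thesis .
qed

lemma ketbra_mult_vec: "ketbra u w *v v = cinner w v *s u"
  by (simp add: vec_eq_iff ketbra_def matrix_vector_mult_def cinner_def sum_distrib_left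
      sum_distrib_right algebra_simps)

lemma ketbra_scaleR: "ketbra (r *\<^sub>R u) (r *\<^sub>R u) = r\<^sup>2 *\<^sub>R ketbra u u"
  by (simp add: vec_eq_iff ketbra_def power2_eq_square)

lemma scaleR_mult_vec: "(r *\<^sub>R A) *v v = of_real r *s (A *v (v :: 'n::finite cvec))"
  by (simp add: vec_eq_iff matrix_vector_mult_def sum_distrib_left mult.assoc
      scaleR_conv_of_real[where 'a = complex])

lemma dagger_ketbra: "dagger (ketbra u u) = ketbra u u"
  by (simp add: vec_eq_iff dagger_def ketbra_def)

lemma dagger_diff: "dagger (A - B) = dagger A - dagger B"
  by (simp add: vec_eq_iff dagger_def)

lemma cnj_entry:
  assumes "dagger A = A"
  shows "cnj (A $ i $ j) = A $ j $ i"
  using arg_cong[OF assms, of "\<lambda>M. M $ j $ i"] by (simp add: dagger_def)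

lemma positive_semidefinite_diag:
  assumes "positive_semidefinite A"
  shows "A $ k $ k = complex_of_real (Re (A $ k $ k))" "0 \<le> Re (A $ k $ k)"
proof -
  have "cnj (A $ k $ k) = A $ k $ k"
    using assms by (simp add: positive_semidefinite_def cnj_entry)
  then show "A $ k $ k = complex_of_real (Re (A $ k $ k))"
    by (simp add: complex_eq_iff)
  have "0 \<le> Re (cinner (axis k 1) (A *v axis k 1))"
    using assms by (simp add: positive_semidefinite_def)
  then show "0 \<le> Re (A $ k $ k)"
    by (simp add: cinner_axis_left matrix_vector_mult_axis column_def)
qed

text \<open>When the diagonal vanishes, the quadratic form at \<open>?w\<close> equals minus twice
  the squared modulus of the \<open>(i, j)\<close> entry, and nonnegativity forces that entry to be
  zero.\<close>

lemma positive_semidefinite_diag_zero: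
  assumes A: "positive_semidefinite A" and diag: "\<And>k. A $ k $ k = 0"
  shows "A = 0"
proof -
  have "A $ i $ j = 0" for i j
  proof -
    let ?w = "axis i 1 - cnj (A $ i $ j) *s axis j 1"
    have "cnj (A $ i $ j) = A $ j $ i" "cnj (A $ j $ i) = A $ i $ j"
      using A by (auto simp: positive_semidefinite_def intro: cnj_entry)
    then have "cinner ?w (A *v ?w) = - 2 * (A $ i $ j * cnj (A $ i $ j))"
      by (simp add: matrix_vector_mult_diff_distrib vector_scalar_commute
          matrix_vector_mult_axis cinner_diff_left cinner_diff_right cinner_scale_left
          cinner_scale_right cinner_axis_left column_def diag algebra_simps)
    then have "Re (cinner ?w (A *v ?w)) = - 2 * (cmod (A $ i $ j))\<^sup>2"
      by (simp add: cmod_power2) (simp add: power2_eq_square)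
    moreover have "0 \<le> Re (cinner ?w (A *v ?w))"
      using A by (simp add: positive_semidefinite_def)
    ultimately show ?thesis by simp
  qed
  then show ?thesis by (simp add: vec_eq_iff)
qed

text \<open>
  A Cholesky step: the form of the difference at \<open>w\<close> is the form of \<open>A\<close> at the projection of \<open>w\<close>
  that is \<open>A\<close>-orthogonal to the basis vector \<open>k\<close>.
\<close>

lemma positive_semidefinite_cholesky_step:
  assumes A: "positive_semidefinite A" and k: "A $ k $ k \<noteq> 0"
  defines "u \<equiv> (1 / sqrt (Re (A $ k $ k))) *\<^sub>R column k A"
  shows "positive_semidefinite (A - ketbra u u)"
    and "(A - ketbra u u) $ k $ k = 0"
    and "Re ((A - ketbra u u) $ i $ i) \<le> Re (A $ i $ i)"
proof -
  define a where "a = Re (A $ k $ k)"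
  have Aa: "A $ k $ k = of_real a" and a: "a > 0"
    using positive_semidefinite_diag[OF A, of k] k unfolding a_def
    by (auto simp: less_le)
  have uu: "ketbra u u = (1 / a) *\<^sub>R ketbra (column k A) (column k A)"
    using a unfolding u_def ketbra_scaleR a_def[symmetric] by (simp add: power_divide)
  have herm: "dagger A = A"
    using A by (simp add: positive_semidefinite_def)
  have "0 \<le> Re (cinner w ((A - ketbra u u) *v w))" for w
  proof -
    \<comment> \<open>Since column \<open>k\<close> is \<open>A\<close> applied to the basis vector
      \<open>k\<close> and \<open>A\<close> is Hermitian, \<open>c\<close> is the coefficient of the
      \<open>A\<close>-orthogonal projection of \<open>w\<close> onto that basis vector.\<close>
    define c where "c = cinner (column k A) w / of_real a"
    have c: "cinner (column k A) w = of_real a * c" "cinner w (column k A) = of_real a * cnj c"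
      using a by (simp_all add: c_def cinner_commute[of w])
    have k1: "(A *v w) $ k = of_real a * c"
    proof -
      have "(A *v w) $ k = cinner (dagger A *v axis k 1) w"
        by (simp add: cinner_dagger cinner_axis_left)
      then show ?thesis by (simp add: herm matrix_vector_mult_axis c)
    qed
    have colk: "column k A $ k = of_real a"
      by (simp add: column_def Aa)
    let ?w = "w - c *s axis k 1"
    have "cinner ?w (A *v ?w) = cinner w (A *v w) - of_real a * c * cnj c"
      using Aa by (simp add: matrix_vector_mult_diff_distrib vector_scalar_commute
          matrix_vector_mult_axis cinner_diff_left cinner_diff_right cinner_scale_left
          cinner_scale_right cinner_axis_left c k1 colk algebra_simps)
    moreover have "cinner w (ketbra u u *v w) = of_real a * c * cnj c"
    proof -
      have "ketbra u u *v w = (of_real (1 / a) * (of_real a * c)) *s column k A"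
        by (simp add: uu scaleR_mult_vec ketbra_mult_vec c)
      then show ?thesis
        using a by (simp add: cinner_scale_right c)
    qed
    ultimately have "cinner w ((A - ketbra u u) *v w) = cinner ?w (A *v ?w)"
      by (simp add: matrix_vector_mult_diff_rdistrib cinner_diff_right)
    then show ?thesis
      using A by (simp add: positive_semidefinite_def)
  qed
  then show "positive_semidefinite (A - ketbra u u)"
    by (simp add: positive_semidefinite_def dagger_diff dagger_ketbra herm)
  show "(A - ketbra u u) $ k $ k = 0"
    using a unfolding uu by (simp add: ketbra_def column_def Aa scaleR_conv_of_real[where 'a = complex])
  show "Re ((A - ketbra u u) $ i $ i) \<le> Re (A $ i $ i)"
    by (simp add: ketbra_def)
qed

text \<open>Induction on the number of nonzero diagonal entries: a Cholesky step clears one of them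
  and revives none. At the end the diagonal vanishes, and with it the matrix.\<close>

lemma positive_semidefinite_sum_ketbra:
  assumes "positive_semidefinite A"
  shows "\<exists>(n::nat) u. A = (\<Sum>i<n. ketbra (u i) (u i))"
  using assms
proof (induction "card {i. A $ i $ i \<noteq> 0}" arbitrary: A rule: less_induct)
  case less
  show ?case
  proof (cases "\<forall>k. A $ k $ k = 0")
    case True
    then have "A = (\<Sum>i<(0::nat). ketbra (0 :: 'a cvec) 0)"
      using positive_semidefinite_diag_zero[OF less.prems] by simp
    then show ?thesis by (intro exI)
  next
    case False
    then obtain k where k: "A $ k $ k \<noteq> 0" by blast
    obtain v where psd: "positive_semidefinite (A - ketbra v v)"
      and zero: "(A - ketbra v v) $ k $ k = 0"
      and le: "\<And>i. Re ((A - ketbra v v) $ i $ i) \<le> Re (A $ i $ i)"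
      using positive_semidefinite_cholesky_step[OF less.prems k] by blast
    have "{i. (A - ketbra v v) $ i $ i \<noteq> 0} \<subset> {i. A $ i $ i \<noteq> 0}"
    proof
      show "{i. (A - ketbra v v) $ i $ i \<noteq> 0} \<subseteq> {i. A $ i $ i \<noteq> 0}"
      proof (intro subsetI CollectI notI, drule CollectD)
        fix i assume i: "(A - ketbra v v) $ i $ i \<noteq> 0" "A $ i $ i = 0"
        \<comment> \<open>A zero diagonal entry stays zero: the new entry is at most the old one and
          cannot be negative.\<close>
        have "Re ((A - ketbra v v) $ i $ i) = 0"
          using le[of i] positive_semidefinite_diag(2)[OF psd, of i] i(2) by simp
        then show False
          using positive_semidefinite_diag(1)[OF psd, of i] i(1) by simp
      qed
      show "{i. (A - ketbra v v) $ i $ i \<noteq> 0} \<noteq> {i. A $ i $ i \<noteq> 0}"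
        using k zero by blast
    qed
    then have "card {i. (A - ketbra v v) $ i $ i \<noteq> 0} < card {i. A $ i $ i \<noteq> 0}"
      by (intro psubset_card_mono) auto
    from less.hyps[OF this psd] obtain n :: nat and u
      where "A - ketbra v v = (\<Sum>i<n. ketbra (u i) (u i))" by blast
    then have "A = (\<Sum>i<Suc n. ketbra ((u(n := v)) i) ((u(n := v)) i))"
      by (simp add: diff_eq_eq)
    then show ?thesis by blast
  qed
qed

lemma trace_sum: "trace (\<Sum>i\<in>I. f i) = (\<Sum>i\<in>I. trace (f i :: 'n::finite cmat))"
  by (simp add: trace_def sum.swap[of _ I])

lemma trace_ketbra: "trace (ketbra u v) = cinner v u"
  by (simp add: trace_def ketbra_def cinner_def mult.commute)

lemma pure_decomposition_exists:
  fixes \<rho> :: "'n::finite cmat"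
  assumes "density_operator \<rho>"
  obtains n p \<psi> where "pure_decomposition \<rho> n p \<psi>"
proof -
  have "positive_semidefinite \<rho>" and tr: "trace \<rho> = 1"
    using assms by (auto simp: density_operator_def positive_semidefinite_def)
  then obtain n :: nat and u where \<rho>: "\<rho> = (\<Sum>i<n. ketbra (u i) (u i))"
    using positive_semidefinite_sum_ketbra by blast
  define p where "p i = (norm (u i))\<^sup>2" for i
  \<comment> \<open>A zero vector cannot be normalized, but its weight is 0, so an arbitrary unit
    vector can stand in for it.\<close>
  define \<psi> :: "nat \<Rightarrow> 'n cvec"
    where "\<psi> i = (if u i = 0 then axis undefined 1 else (1 / norm (u i)) *\<^sub>R u i)" for i
  have scale: "p i *\<^sub>R ketbra (\<psi> i) (\<psi> i) = ketbra (u i) (u i)" for i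
  proof (cases "u i = 0")
    case True
    then show ?thesis by (simp add: p_def ketbra_def vec_eq_iff)
  next
    case False
    then show ?thesis
      by (simp add: p_def \<psi>_def ketbra_scaleR power_divide)
  qed
  have "complex_of_real (\<Sum>i<n. p i) = trace \<rho>"
    by (simp add: \<rho> trace_sum trace_ketbra cinner_self p_def)
  then have "(\<Sum>i<n. p i) = 1"
    using tr by (metis of_real_eq_1_iff)
  moreover have "norm (axis undefined 1 :: 'n cvec) = 1"
    using cinner_self[of "axis undefined 1 :: 'n cvec"]
    by (simp add: cinner_axis_left flip: of_real_power)
  then have "norm (\<psi> i) = 1" for i
    by (simp add: \<psi>_def)
  moreover have "0 \<le> p i" for i
    by (simp add: p_def)
  ultimately have "pure_decomposition \<rho> n p \<psi>"
    by (simp add: pure_decomposition_def scale \<rho>[symmetric])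
  then show thesis by (rule that)
qed

section \<open>The convex roof is attained\<close>

definition pure_graph :: "((2 \<times> 2) cmat \<times> real) set" where
  "pure_graph = (\<lambda>\<psi>. (ketbra \<psi> \<psi>, pure_concurrence \<psi>)) ` sphere 0 1"

lemma compact_pure_graph: "compact pure_graph"
  unfolding pure_graph_def
proof (rule compact_continuous_image)
  show "continuous_on (sphere 0 1)
      (\<lambda>\<psi> :: (2 \<times> 2) cvec. (ketbra \<psi> \<psi>, pure_concurrence \<psi>))"
    unfolding ketbra_def pure_concurrence_def
    by (intro continuous_intros)
qed simp

text \<open>Pairing each projector with its concurrence lets one convex combination average both, so
  the fibre of the hull over \<rho> consists of the values of all decompositions of \<rho>.\<close>

lemma convex_hull_pure_graph:
  "(\<rho>, c) \<in> convex hull pure_graph \<longleftrightarrow>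
   (\<exists>n p \<psi>. pure_decomposition \<rho> n p \<psi> \<and> c = (\<Sum>i<n. p i * pure_concurrence (\<psi> i)))"
  (is "?L \<longleftrightarrow> ?R")
proof
  assume ?L
  then obtain k :: nat and u x where ux: "\<forall>i\<in>{1..k}. 0 \<le> u i \<and> x i \<in> pure_graph"
    and u1: "sum u {1..k} = 1" and s: "(\<Sum>i=1..k. u i *\<^sub>R x i) = (\<rho>, c)"
    unfolding convex_hull_indexed by auto
  have "\<forall>i\<in>{1..k}. \<exists>\<psi>. norm \<psi> = 1 \<and> x i = (ketbra \<psi> \<psi>, pure_concurrence \<psi>)"
    using ux unfolding pure_graph_def by (force simp: image_iff)
  then obtain \<psi> where \<psi>: "\<And>i. i \<in> {1..k} \<Longrightarrow> norm (\<psi> i) = 1"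
    "\<And>i. i \<in> {1..k} \<Longrightarrow> x i = (ketbra (\<psi> i) (\<psi> i), pure_concurrence (\<psi> i))"
    by metis
  \<comment> \<open>\<open>convex_hull_indexed\<close> numbers its points from 1, a
    \<open>pure_decomposition\<close> from 0.\<close>
  have shift: "(\<Sum>i<k. f (Suc i)) = (\<Sum>i=1..k. f i)" for f :: "nat \<Rightarrow> 'z::comm_monoid_add"
    by (simp add: sum.atLeast1_atMost_eq)
  have "\<rho> = fst (\<Sum>i=1..k. u i *\<^sub>R x i)" "c = snd (\<Sum>i=1..k. u i *\<^sub>R x i)"
    using s by auto
  then have "\<rho> = (\<Sum>i=1..k. u i *\<^sub>R ketbra (\<psi> i) (\<psi> i))"
    "c = (\<Sum>i=1..k. u i * pure_concurrence (\<psi> i))"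
    using \<psi>(2) by (auto simp: fst_sum snd_sum intro!: sum.cong)
  then have "pure_decomposition \<rho> k (u \<circ> Suc) (\<psi> \<circ> Suc) \<and>
      c = (\<Sum>i<k. (u \<circ> Suc) i * pure_concurrence ((\<psi> \<circ> Suc) i))"
    using ux u1 \<psi>(1)
    by (auto simp: pure_decomposition_def shift[of u] shift[of "\<lambda>i. u i *\<^sub>R ketbra (\<psi> i) (\<psi> i)"]
        shift[of "\<lambda>i. u i * pure_concurrence (\<psi> i)"])
  then show ?R by blast
next
  assume ?R
  then obtain n p \<psi> where d: "pure_decomposition \<rho> n p \<psi>"
    and c: "c = (\<Sum>i<n. p i * pure_concurrence (\<psi> i))" by blast
  have "(\<Sum>i<n. p i *\<^sub>R (ketbra (\<psi> i) (\<psi> i), pure_concurrence (\<psi> i))) \<in> convex hull pure_graph"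
    using d by (intro convex_sum)
      (auto simp: pure_decomposition_def pure_graph_def intro!: hull_inc)
  also have "(\<Sum>i<n. p i *\<^sub>R (ketbra (\<psi> i) (\<psi> i), pure_concurrence (\<psi> i))) = (\<rho>, c)"
    using d c by (simp add: pure_decomposition_def prod_eq_iff fst_sum snd_sum)
  finally show ?L .
qed

text \<open>The fibre over \<rho> of the compact convex hull is compact, and it is nonempty because
  \<rho> has a decomposition. Its real coordinates therefore have a least element, which is what
  gives \<open>LEAST\<close> over the reals its meaning.\<close>

lemma concurrence_attained:
  assumes "density_operator \<rho>"
  obtains n p \<psi> where "pure_decomposition \<rho> n p \<psi>"
    "concurrence \<rho> = (\<Sum>i<n. p i * pure_concurrence (\<psi> i))"
proof -
  let ?C = "{c. (\<rho>, c) \<in> convex hull pure_graph}"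
  have "compact ((convex hull pure_graph) \<inter> ({\<rho>} \<times> UNIV))"
    by (intro compact_Int_closed compact_convex_hull compact_pure_graph closed_Times) auto
  then have "compact (snd ` ((convex hull pure_graph) \<inter> ({\<rho>} \<times> UNIV)))"
    by (intro compact_continuous_image continuous_intros)
  also have "snd ` ((convex hull pure_graph) \<inter> ({\<rho>} \<times> UNIV)) = ?C"
    by force
  finally have "compact ?C" .
  moreover have "?C \<noteq> {}"
    using pure_decomposition_exists[OF assms] unfolding convex_hull_pure_graph by blast
  ultimately obtain c where c: "c \<in> ?C" "\<And>t. t \<in> ?C \<Longrightarrow> c \<le> t"
    using compact_attains_inf by metis
  then have "concurrence \<rho> = c"
    unfolding concurrence_def convex_hull_pure_graph[symmetric]
    by (intro Least_equality) auto
  with c(1) show thesis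
    using that unfolding convex_hull_pure_graph by blast
qed

section \<open>The swap test measures the expectation of the swap operator\<close>

lemma tensor_mat_mult: "(A \<otimes>\<^sub>m B) ** (C \<otimes>\<^sub>m D) = (A ** C) \<otimes>\<^sub>m (B ** D)"
  by (simp add: vec_eq_iff tensor_mat_def matrix_matrix_mult_def sum_product
      UNIV_Times_UNIV[symmetric] sum.cartesian_product case_prod_unfold ac_simps
      del: UNIV_Times_UNIV)

lemma matrix_add_rdistrib: "((A :: 'n::finite cmat) + B) ** C = A ** C + B ** C"
  by (simp add: vec_eq_iff matrix_matrix_mult_def sum.distrib algebra_simps)

lemma trace_tensor_mat: "trace (A \<otimes>\<^sub>m B) = trace A * trace B"
  by (simp add: trace_def tensor_mat_def sum_product UNIV_Times_UNIV[symmetric]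
      sum.cartesian_product case_prod_unfold del: UNIV_Times_UNIV)

lemma dagger_tensor_mat: "dagger (A \<otimes>\<^sub>m B) = dagger A \<otimes>\<^sub>m dagger B"
  by (simp add: vec_eq_iff dagger_def tensor_mat_def)

lemma dagger_add: "dagger (A + B) = dagger A + dagger B"
  by (simp add: vec_eq_iff dagger_def)

lemma dagger_mat_1: "dagger (mat 1) = mat 1"
  by (simp add: vec_eq_iff dagger_def mat_def)

lemma dagger_swap_op: "dagger swap_op = swap_op"
  by (auto simp: vec_eq_iff dagger_def swap_op_def prod.swap_def)

lemma UNIV_2_eq: "(UNIV :: 2 set) = {0, 1}"
proof -
  \<comment> \<open>In the numeral type \<open>2\<close> the literal \<open>2\<close> denotes
    \<open>0\<close>.\<close>
  have "{1, 2 :: 2} = {0, 1}" by auto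
  then show ?thesis by (simp only: UNIV_2)
qed

lemma swap_op_mult: "(swap_op ** A) $ i $ j = A $ prod.swap i $ j"
proof -
  have "(swap_op ** A) $ i $ j = (\<Sum>k\<in>UNIV. if k = prod.swap i then A $ k $ j else 0)"
    unfolding matrix_matrix_mult_def swap_op_def vec_lambda_beta
    by (rule sum.cong) auto
  then show ?thesis by simp
qed

lemma swap_op_involution: "swap_op ** swap_op = mat 1"
  by (auto simp: vec_eq_iff swap_op_mult mat_def) (auto simp: swap_op_def)

text \<open>Conjugation by the Hadamard gate turns the control projectors into the projectors
  \<open>A\<close> and \<open>B\<close> onto the plus and minus states. From ancilla 0 to ancilla 1
  the circuit thus applies (1 - S)/2 to the target, where S is the swap. As S is an involution,
  cyclicity of the trace leaves (1 - Tr(S \<rho>))/2.\<close>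

lemma prob_one_eq:
  assumes "trace \<rho> = 1"
  shows "prob_one \<rho> = (1 - Re (trace (swap_op ** \<rho>))) / 2"
proof -
  define A where "A = hadamard ** ketbra (ket 0) (ket 0) ** hadamard"
  define B where "B = hadamard ** ketbra (ket 1) (ket 1) ** hadamard"
  let ?P0 = "ketbra (ket 0) (ket 0) :: 2 cmat" and ?P1 = "ketbra (ket 1) (ket 1) :: 2 cmat"
  have r2: "complex_of_real (sqrt 2) * complex_of_real (sqrt 2) = 2"
    by (simp flip: of_real_mult)
  have A: "A = (\<chi> i j. 1 / 2)"
    by (auto simp: A_def vec_eq_iff matrix_matrix_mult_def hadamard_def ketbra_def ket_def axis_def
        UNIV_2_eq r2)
  have B: "B = (\<chi> i j. if i = j then 1 / 2 else - 1 / 2)"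
  proof -
    have "B $ i $ j = (if i = j then 1 / 2 else - 1 / 2)" for i j
      using exhaust_2[of i] exhaust_2[of j]
      by (auto simp: B_def matrix_matrix_mult_def hadamard_def ketbra_def ket_def axis_def
        UNIV_2_eq r2)
    then show ?thesis by (simp add: vec_eq_iff)
  qed
  have U: "swap_test_unitary = mat 1 \<otimes>\<^sub>m A + swap_op \<otimes>\<^sub>m B"
    by (simp add: swap_test_unitary_def cswap_gate_def A_def B_def tensor_mat_mult
        matrix_add_ldistrib matrix_add_rdistrib)
  have "dagger A = A" "dagger B = B"
    by (auto simp: A B vec_eq_iff dagger_def)
  then have U': "dagger swap_test_unitary = swap_test_unitary"
    by (simp add: U dagger_add dagger_tensor_mat dagger_mat_1 dagger_swap_op)
  have tr: "trace (?P1 ** (X ** ?P0 ** Y)) = X $ 1 $ 0 * Y $ 0 $ 1" for X Y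
    by (simp add: trace_def matrix_matrix_mult_def ketbra_def ket_def axis_def UNIV_2_eq)
  \<comment> \<open>The off-diagonal entries are 1/2 for \<open>A\<close> and -1/2 for
    \<open>B\<close>, so by \<open>tr\<close> each of the four terms has weight 1/4, with a minus
    sign on the mixed ones.\<close>
  have "trace ((mat 1 \<otimes>\<^sub>m ?P1) **
      (swap_test_unitary ** (\<rho> \<otimes>\<^sub>m ?P0) ** dagger swap_test_unitary)) =
      trace \<rho> / 4 - trace (swap_op ** \<rho>) / 4 - trace (\<rho> ** swap_op) / 4
        + trace (swap_op ** \<rho> ** swap_op) / 4"
    unfolding U' unfolding U
    by (simp add: matrix_add_ldistrib matrix_add_rdistrib tensor_mat_mult trace_add
        trace_tensor_mat tr) (simp add: A B)
  also have "trace (\<rho> ** swap_op) = trace (swap_op ** \<rho>)"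
    by (rule trace_mul_sym)
  also have "trace (swap_op ** \<rho> ** swap_op) = trace \<rho>"
    by (metis trace_mul_sym matrix_mul_assoc swap_op_involution matrix_mul_lid)
  finally show ?thesis
    using assms by (simp add: prob_one_def)
qed

section \<open>The swap operator on pure states and on separable states\<close>

lemma trace_swap_op_mult:
  "trace (swap_op ** \<rho>) =
     \<rho> $ (0,0) $ (0,0) + \<rho> $ (1,1) $ (1,1) + \<rho> $ (1,0) $ (0,1) + \<rho> $ (0,1) $ (1,0)"
  by (simp add: trace_def swap_op_mult UNIV_Times_UNIV[symmetric] UNIV_2_eq
      del: UNIV_Times_UNIV)

lemma trace_swap_op_tensor:
  "trace (swap_op ** (\<sigma> \<otimes>\<^sub>m \<tau>)) = trace (\<sigma> ** \<tau>)"
  by (simp add: trace_swap_op_mult tensor_mat_def)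
    (simp add: trace_def matrix_matrix_mult_def UNIV_2_eq)

text \<open>The reverse triangle inequality bounds the concurrence below by twice |cd| - |ab|, and
  the arithmetic-geometric mean inequality absorbs 2|ab| into the two diagonal terms of the
  trace.\<close>

lemma pure_concurrence_ge:
  "- Re (trace (swap_op ** ketbra \<psi> \<psi>)) \<le> pure_concurrence \<psi>"
proof -
  define a b c d where abcd: "a = \<psi> $ (0,0)" "b = \<psi> $ (1,1)" "c = \<psi> $ (1,0)" "d = \<psi> $ (0,1)"
  have "Re (trace (swap_op ** ketbra \<psi> \<psi>)) = (cmod a)\<^sup>2 + (cmod b)\<^sup>2 + 2 * Re (c * cnj d)"
    by (simp add: trace_swap_op_mult ketbra_def abcd cmod_power2) (simp add: power2_eq_square)
  moreover have "- Re (c * cnj d) \<le> cmod c * cmod d"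
    using abs_Re_le_cmod[of "c * cnj d"] by (simp add: norm_mult)
  moreover have "cmod c * cmod d - cmod a * cmod b \<le> cmod (a * b - c * d)"
    using norm_triangle_ineq2[of "c * d" "a * b"] by (simp add: norm_mult norm_minus_commute)
  moreover have "2 * (cmod a * cmod b) \<le> (cmod a)\<^sup>2 + (cmod b)\<^sup>2"
    using sum_squares_bound[of "cmod a" "cmod b"] by simp
  ultimately show ?thesis
    unfolding pure_concurrence_def abcd[symmetric] by linarith
qed

text \<open>Real linearity suffices, since the weights of mixtures are real; it serves both
  pure-state decompositions and the convex hull of product states.\<close>

lemma linear_trace_mult: "linear (\<lambda>\<rho> :: 'n::finite cmat. Re (trace (A ** \<rho>)))"
proof
  show "Re (trace (A ** (x + y))) = Re (trace (A ** x)) + Re (trace (A ** y))" for x y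
    by (simp add: matrix_add_ldistrib trace_add)
  show "Re (trace (A ** (r *\<^sub>R x))) = r *\<^sub>R Re (trace (A ** x))" for r x
    by (simp add: trace_def matrix_matrix_mult_def sum_distrib_left)
qed

lemma trace_mult_pure_decomposition:
  assumes "pure_decomposition \<rho> n p \<psi>"
  shows "Re (trace (A ** \<rho>)) = (\<Sum>i<n. p i * Re (trace (A ** ketbra (\<psi> i) (\<psi> i))))"
proof -
  have "\<rho> = (\<Sum>i<n. p i *\<^sub>R ketbra (\<psi> i) (\<psi> i))"
    using assms by (simp add: pure_decomposition_def)
  then show ?thesis
    by (simp add: linear_sum[OF linear_trace_mult] linear_cmul[OF linear_trace_mult])
qed

lemma trace_mult_ketbra: "trace (A ** ketbra u v) = cinner v (A *v u)"
  by (simp add: trace_def matrix_matrix_mult_def ketbra_def cinner_def matrix_vector_mult_def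
      sum_distrib_left algebra_simps)

text \<open>Decomposing \<tau> into pure states makes the trace a nonnegative combination of values
  of the quadratic form of \<sigma>.\<close>

lemma trace_mult_density_nonneg:
  assumes "density_operator \<sigma>" "density_operator \<tau>"
  shows "0 \<le> Re (trace (\<sigma> ** \<tau>))"
proof -
  obtain n p \<psi> where d: "pure_decomposition \<tau> n p \<psi>"
    using assms(2) by (rule pure_decomposition_exists)
  show ?thesis
    unfolding trace_mult_pure_decomposition[OF d] trace_mult_ketbra
    using assms(1) d
    by (intro sum_nonneg mult_nonneg_nonneg) (auto simp: pure_decomposition_def density_operator_def)
qed

text \<open>The swap operator is an entanglement witness: the half-space \<open>?H\<close> is convex
  and contains all product states, hence their convex hull.\<close>

lemma separable_trace_swap_op_nonneg:
  assumes "separable_state \<rho>"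
  shows "0 \<le> Re (trace (swap_op ** \<rho>))"
proof -
  let ?S = "{\<sigma> \<otimes>\<^sub>m \<tau> | (\<sigma> :: 2 cmat) (\<tau> :: 2 cmat). density_operator \<sigma> \<and> density_operator \<tau>}"
  let ?H = "{\<rho>. 0 \<le> Re (trace (swap_op ** \<rho>))}"
  have "?H = (\<lambda>\<rho>. Re (trace (swap_op ** \<rho>))) -` {0..}"
    by auto
  then have "convex ?H"
    by (simp add: convex_linear_vimage[OF linear_trace_mult])
  moreover have "?S \<subseteq> ?H"
    by (auto simp: trace_swap_op_tensor trace_mult_density_nonneg)
  ultimately have "convex hull ?S \<subseteq> ?H"
    by (intro hull_minimal)
  with assms show ?thesis
    unfolding separable_state_def by blast
qed

theorem mainTheorem3:
  fixes \<rho> :: "(2 \<times> 2) cmat"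
  assumes "density_operator \<rho>"
  shows "concurrence \<rho> \<ge> concurrence_bound (prob_one \<rho>) \<and>
         (prob_one \<rho> > 1/2 \<longrightarrow> entangled \<rho>)"
proof
  have prob: "prob_one \<rho> = (1 - Re (trace (swap_op ** \<rho>))) / 2"
    using assms by (intro prob_one_eq) (simp add: density_operator_def)
  obtain n p \<psi> where d: "pure_decomposition \<rho> n p \<psi>"
    and c: "concurrence \<rho> = (\<Sum>i<n. p i * pure_concurrence (\<psi> i))"
    using assms by (rule concurrence_attained)
  have p: "0 \<le> p i" if "i < n" for i
    using d that by (simp add: pure_decomposition_def)
  have "2 * prob_one \<rho> - 1 = (\<Sum>i<n. p i * - Re (trace (swap_op ** ketbra (\<psi> i) (\<psi> i))))"
    by (simp add: prob trace_mult_pure_decomposition[OF d] sum_negf diff_divide_distrib)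
  also have "\<dots> \<le> concurrence \<rho>"
    unfolding c by (intro sum_mono mult_left_mono pure_concurrence_ge) (simp add: p)
  finally have "2 * prob_one \<rho> - 1 \<le> concurrence \<rho>" .
  \<comment> \<open>This settles the branch of \<open>concurrence_bound\<close> up to 1/2; the
    inequality before it settles the other.\<close>
  moreover have "0 \<le> concurrence \<rho>"
    unfolding c by (intro sum_nonneg mult_nonneg_nonneg) (auto simp: p pure_concurrence_def)
  ultimately show "concurrence \<rho> \<ge> concurrence_bound (prob_one \<rho>)"
    by (simp add: concurrence_bound_def)
  \<comment> \<open>The witness gives this directly, without the concurrence: a probability above
    1/2 means a negative trace against the swap.\<close>
  show "prob_one \<rho> > 1/2 \<longrightarrow> entangled \<rho>"
    using separable_trace_swap_op_nonneg[of \<rho>] by (auto simp: prob entangled_def)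
qed

end
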